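(* For all $k\ge1$, $$\sum_{n\ge0}|\mathfrak S_n(1243,2143,12\ldots k)|\,x^n=1+\frac{\sqrt{x}\,U_{k-2}\!\left(\frac{1-x}{2\sqrt x}\right)}{U_{k-1}\!\left(\frac{1-x}{2\sqrt x}\right)}$$ and $$\sum_{n\ge0}|\mathfrak S_n(1243,2143,213\ldots k)|\,x^n=1+\frac{\sqrt{x}\,U_{k-2}\!\left(\frac{1-x}{2\sqrt x}\right)}{U_{k-1}\!\left(\frac{1-x}{2\sqrt x}\right)}.$$
   Context: $\mathfrak S_n(R)$ is the set of permutations of $\{1,\dots,n\}$ avoiding every pattern in $R$ (a permutation avoids $\sigma$ if it has no subsequence with the same relative order as $\sigma$). $12\ldots k$ is the identity permutation of length $k$ and $213\ldots k$ is the permutation $2,1,3,4,\dots,k$. $U_n$ is the Chebyshev polynomial of the second kind: $U_{-1}=0$, $U_n(\cos t)=\sin((n+1)t)/\sin t$ for $n\ge0$, equivalently $U_0=1$, $U_n(y)=2yU_{n-1}(y)-U_{n-2}(y)$. *)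

theory Defs
  imports Complex_Main "HOL-Library.Sublist"
begin

definition perms :: "nat \<Rightarrow> nat list set" where
  "perms n = {\<pi>. distinct \<pi> \<and> set \<pi> = {1..n}}"

definition contains :: "nat list \<Rightarrow> nat list \<Rightarrow> bool" where
  "contains \<pi> \<sigma> \<longleftrightarrow> (\<exists>\<tau>. subseq \<tau> \<pi> \<and> length \<tau> = length \<sigma> \<and>
      (\<forall>i<length \<sigma>. \<forall>j<length \<sigma>. (\<tau> ! i < \<tau> ! j \<longleftrightarrow> \<sigma> ! i < \<sigma> ! j)))"

definition avoids :: "nat list \<Rightarrow> nat list \<Rightarrow> bool" where
  "avoids \<pi> \<sigma> \<longleftrightarrow> \<not> contains \<pi> \<sigma>"

definition Av :: "nat \<Rightarrow> nat list set \<Rightarrow> nat list set" where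
  "Av n R = {\<pi> \<in> perms n. \<forall>\<sigma>\<in>R. avoids \<pi> \<sigma>}"

definition idpat :: "nat \<Rightarrow> nat list" where
  "idpat k = [1..<k+1]"

text \<open>213...k (for k = 1 read as the length-1 pattern 1)\<close>
definition pat213 :: "nat \<Rightarrow> nat list" where
  "pat213 k = (if k < 2 then [1..<k+1] else [2, 1] @ [3..<k+1])"

text \<open>chebV n y = U_{n-1}(y)\<close>
fun chebV :: "nat \<Rightarrow> real \<Rightarrow> real" where
  "chebV 0 y = 0"
| "chebV (Suc 0) y = 1"
| "chebV (Suc (Suc n)) y = 2 * y * chebV (Suc n) y - chebV n y"

text \<open>Chebyshev polynomial of the second kind U_n for n \<ge> -1\<close>
definition chebU :: "int \<Rightarrow> real \<Rightarrow> real" where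
  "chebU n y = chebV (nat (n + 1)) y"

end

(*
Let n be the largest entry of a nonempty permutation A n B avoiding 1243 and 2143. If A is nonempty
with least entry b, then every other entry of A exceeds all entries of B, since otherwise two
entries of A, n and an entry of B would form 1243 or 2143. So A n B is encoded by the pair of the
standardisation of A and the word b B. If the pattern s+1 arises from s by appending a new maximum,
then A n B avoids s+1 iff A avoids s and b B avoids s+1. Hence the generating functions F_s of
nonempty avoiders satisfy F_{s+1} = x + x F_{s+1} + F_s F_{s+1}, that is,
F_{s+1} = x / (1 - x - F_s), which is the recurrence of the quotients of Chebyshev polynomials.
For 0 < x < 1/6 the bound F_s \<le> 1/2 propagates along the recurrence, so that all series converge
on this common interval.
*)

theory Submission
  imports Defs
begin

section \<open>Pattern containment under monotone relabelling, and the pair 1243, 2143\<close>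

definition order_iso :: "nat list \<Rightarrow> nat list \<Rightarrow> bool" where
  "order_iso \<tau> \<sigma> \<longleftrightarrow> length \<tau> = length \<sigma> \<and>
     (\<forall>i<length \<sigma>. \<forall>j<length \<sigma>. \<tau> ! i < \<tau> ! j \<longleftrightarrow> \<sigma> ! i < \<sigma> ! j)"

lemma contains_iff: "contains \<pi> \<sigma> \<longleftrightarrow> (\<exists>\<tau>. subseq \<tau> \<pi> \<and> order_iso \<tau> \<sigma>)"
  unfolding contains_def order_iso_def by blast

lemma contains_mono: "subseq \<pi> \<pi>' \<Longrightarrow> contains \<pi> \<sigma> \<Longrightarrow> contains \<pi>' \<sigma>"
  unfolding contains_def by (meson subseq_order.trans)

lemma subseq_mapE:
  assumes "subseq zs (map f xs)"
  obtains ys where "zs = map f ys" "subseq ys xs"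
  using assms by (metis nths_map subseq_conv_nths)

text \<open>On a linear order a strictly increasing map also reflects comparisons. Avoidance thus
  passes to relabelled words: from \<open>\<gamma>\<close> to the block A when gluing, and from A to
  its standardisation when decomposing.\<close>

lemma contains_mapD:
  assumes "contains (map f \<pi>) \<sigma>" and f: "strict_mono_on (set \<pi>) f"
  shows "contains \<pi> \<sigma>"
proof -
  obtain zs where zs: "subseq zs (map f \<pi>)" "order_iso zs \<sigma>"
    using assms(1) contains_iff by auto
  obtain ys where ys: "zs = map f ys" "subseq ys \<pi>"
    using zs(1) subseq_mapE by blast
  have "set ys \<subseteq> set \<pi>" using ys(2) by (auto dest: list_emb_set)
  then have "f u < f v \<longleftrightarrow> u < v" if "u \<in> set ys" "v \<in> set ys" for u v
    using f that by (simp add: strict_mono_on_less subset_eq)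
  then have "order_iso ys \<sigma>"
    using zs(2) by (auto simp: order_iso_def ys(1))
  then show ?thesis using ys(2) contains_iff by blast
qed

text \<open>For a list of distinct entries, avoiding both 1243 and 2143 means that this fails: the two
  smallest entries of an occurrence may come in either order.\<close>

definition has_x43 :: "nat list \<Rightarrow> bool" where
  "has_x43 \<pi> \<longleftrightarrow> (\<exists>a b c d. subseq [a, b, d, c] \<pi> \<and> a < c \<and> b < c \<and> c < d)"

lemma has_x43_mono: "subseq \<pi> \<pi>' \<Longrightarrow> has_x43 \<pi> \<Longrightarrow> has_x43 \<pi>'"
  unfolding has_x43_def by (meson subseq_order.trans)

lemma has_x43_mapD:
  assumes "has_x43 (map f \<pi>)" and f: "strict_mono_on (set \<pi>) f"
  shows "has_x43 \<pi>"
proof -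
  obtain a b c d where *: "subseq [a, b, d, c] (map f \<pi>)" "a < c" "b < c" "c < d"
    using assms(1) has_x43_def by auto
  obtain ys where ys: "[a, b, d, c] = map f ys" "subseq ys \<pi>"
    using *(1) subseq_mapE by blast
  obtain a' b' c' d' where ys': "ys = [a', b', d', c']" "a = f a'" "b = f b'" "c = f c'" "d = f d'"
    using ys(1) by (auto simp: Cons_eq_map_conv)
  have "set ys \<subseteq> set \<pi>" using ys(2) by (auto dest: list_emb_set)
  then have "f u < f v \<longleftrightarrow> u < v" if "u \<in> set ys" "v \<in> set ys" for u v
    using f that by (simp add: strict_mono_on_less subset_eq)
  then show ?thesis using * ys ys' unfolding has_x43_def by auto
qed

text \<open>The order of \<open>a\<close> and \<open>b\<close> decides which of the two patterns
  occurs; distinctness excludes a tie.\<close>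

lemma has_x43_iff:
  assumes "distinct \<pi>"
  shows "has_x43 \<pi> \<longleftrightarrow> contains \<pi> [1, 2, 4, 3] \<or> contains \<pi> [2, 1, 4, 3]"
proof
  assume "has_x43 \<pi>"
  then obtain a b c d where *: "subseq [a, b, d, c] \<pi>" "a < c" "b < c" "c < d"
    using has_x43_def by auto
  have "distinct [a, b, d, c]" using *(1) assms by (metis distinct_nthsI subseq_conv_nths)
  then consider "a < b" | "b < a" by fastforce
  then show "contains \<pi> [1, 2, 4, 3] \<or> contains \<pi> [2, 1, 4, 3]"
  proof cases
    case 1
    then have "order_iso [a, b, d, c] [1, 2, 4, 3]"
      using * by (auto simp: order_iso_def All_less_Suc numeral_eq_Suc less_Suc_eq nth_Cons')
    then show ?thesis using *(1) contains_iff by blast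
  next
    case 2
    then have "order_iso [a, b, d, c] [2, 1, 4, 3]"
      using * by (auto simp: order_iso_def All_less_Suc numeral_eq_Suc less_Suc_eq nth_Cons')
    then show ?thesis using *(1) contains_iff by blast
  qed
next
  \<comment> \<open>Only \<open>p < 3\<close> and \<open>q < 3\<close> matter here, so both patterns
    are instances of one argument.\<close>
  have "has_x43 \<pi>" if "contains \<pi> [p, q, 4, 3]" "p < 3" "q < 3" for p q
  proof -
    obtain zs where zs: "subseq zs \<pi>" "order_iso zs [p, q, 4, 3]"
      using \<open>contains \<pi> _\<close> contains_iff by auto
    then obtain a b c d where abcd: "zs = [a, b, d, c]"
      by (auto simp: order_iso_def length_Suc_conv)
    have o: "\<forall>i<4. \<forall>j<4. zs ! i < zs ! j \<longleftrightarrow> [p, q, 4, 3] ! i < [p, q, 4, 3] ! j"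
      using zs(2) by (simp add: order_iso_def)
    have "a < c" using o[rule_format, of 0 3] that by (simp add: abcd)
    moreover have "b < c" using o[rule_format, of 1 3] that by (simp add: abcd)
    moreover have "c < d" using o[rule_format, of 3 2] that by (simp add: abcd)
    ultimately show ?thesis using zs(1) abcd has_x43_def by blast
  qed
  from this[of 1 2] this[of 2 1]
  show "contains \<pi> [1, 2, 4, 3] \<or> contains \<pi> [2, 1, 4, 3] \<Longrightarrow> has_x43 \<pi>"
    by auto
qed

definition Av3 :: "nat list \<Rightarrow> nat \<Rightarrow> nat list set" where
  "Av3 \<tau> n = Av n {[1, 2, 4, 3], [2, 1, 4, 3], \<tau>}"

lemma Av3_iff:
  "\<pi> \<in> Av3 \<tau> n \<longleftrightarrow> distinct \<pi> \<and> set \<pi> = {1..n} \<and> \<not> has_x43 \<pi> \<and> \<not> contains \<pi> \<tau>"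
  using has_x43_iff by (auto simp: Av3_def Av_def perms_def avoids_def)

lemma length_Av3: "\<pi> \<in> Av3 \<tau> n \<Longrightarrow> length \<pi> = n"
  using distinct_card[of \<pi>] by (simp add: Av3_iff)

lemma finite_Av3: "finite (Av3 \<tau> n)"
proof (rule finite_subset)
  show "Av3 \<tau> n \<subseteq> {xs. set xs \<subseteq> {1..n} \<and> length xs = n}"
    using length_Av3 by (auto simp: Av3_iff)
qed (simp add: finite_lists_length_eq)

section \<open>Patterns ending in their maximum\<close>

text \<open>As \<open>M\<close> exceeds every letter of \<open>\<sigma>\<close>, its comparisons
  with them say exactly that the last entry of an occurrence exceeds all the others.\<close>

lemma order_iso_snoc:
  assumes "\<forall>s\<in>set \<sigma>. s < M"
  shows "order_iso zs (\<sigma> @ [M]) \<longleftrightarrow>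
    (\<exists>\<rho> y. zs = \<rho> @ [y] \<and> order_iso \<rho> \<sigma> \<and> (\<forall>v\<in>set \<rho>. v < y))"
proof
  assume L: "order_iso zs (\<sigma> @ [M])"
  then have "zs \<noteq> []" by (auto simp: order_iso_def)
  then obtain \<rho> y where zs: "zs = \<rho> @ [y]" by (metis rev_exhaust)
  have len: "length \<rho> = length \<sigma>" using L by (simp add: order_iso_def zs)
  have o: "(\<rho> @ [y]) ! i < (\<rho> @ [y]) ! j \<longleftrightarrow> (\<sigma> @ [M]) ! i < (\<sigma> @ [M]) ! j"
    if "i < Suc (length \<sigma>)" "j < Suc (length \<sigma>)" for i j
    using L that by (simp add: order_iso_def zs)
  have "order_iso \<rho> \<sigma>"
    unfolding order_iso_def
  proof (intro conjI allI impI)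
    show "\<rho> ! i < \<rho> ! j \<longleftrightarrow> \<sigma> ! i < \<sigma> ! j" if "i < length \<sigma>" "j < length \<sigma>" for i j
      using o[of i j] that len by (simp add: nth_append)
  qed (fact len)
  moreover have "v < y" if v: "v \<in> set \<rho>" for v
  proof -
    obtain i where i: "i < length \<rho>" "v = \<rho> ! i" using v by (metis in_set_conv_nth)
    have "\<sigma> ! i < M" using i(1) len assms by simp
    then show ?thesis using o[of i "length \<sigma>"] len i by (simp add: nth_append)
  qed
  ultimately show "\<exists>\<rho> y. zs = \<rho> @ [y] \<and> order_iso \<rho> \<sigma> \<and> (\<forall>v\<in>set \<rho>. v < y)"
    using zs by blast
next
  assume "\<exists>\<rho> y. zs = \<rho> @ [y] \<and> order_iso \<rho> \<sigma> \<and> (\<forall>v\<in>set \<rho>. v < y)"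
  then obtain \<rho> y where *: "zs = \<rho> @ [y]" "order_iso \<rho> \<sigma>" "\<forall>v\<in>set \<rho>. v < y" by blast
  have len: "length \<rho> = length \<sigma>" using *(2) by (simp add: order_iso_def)
  have "(\<rho> @ [y]) ! i < (\<rho> @ [y]) ! j \<longleftrightarrow> (\<sigma> @ [M]) ! i < (\<sigma> @ [M]) ! j"
    if "i < Suc (length \<sigma>)" "j < Suc (length \<sigma>)" for i j
  proof -
    have y: "\<rho> ! i' < y" "\<sigma> ! i' < M" if "i' < length \<sigma>" for i'
      using *(3) assms that len by auto
    show ?thesis
      using *(2) that y[of i] y[of j] len
      by (auto simp: order_iso_def less_Suc_eq nth_append)
  qed
  then show "order_iso zs (\<sigma> @ [M])"
    using len by (simp add: order_iso_def *(1))
qed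

lemma contains_snoc_iff:
  assumes "\<forall>s\<in>set \<sigma>. s < M"
  shows "contains \<pi> (\<sigma> @ [M]) \<longleftrightarrow>
    (\<exists>\<rho> y. subseq (\<rho> @ [y]) \<pi> \<and> order_iso \<rho> \<sigma> \<and> (\<forall>v\<in>set \<rho>. v < y))"
  unfolding contains_iff order_iso_snoc[OF assms] by blast

lemma subseq_snocE:
  assumes "subseq (\<rho> @ [y]) (xs @ [z])"
  obtains (skip) "subseq (\<rho> @ [y]) xs" | (take) "y = z" "subseq \<rho> xs"
proof -
  obtain us vs where uv: "\<rho> @ [y] = us @ vs" "subseq us xs" "subseq vs [z]"
    using subseq_appendE[OF assms] by metis
  have "vs = [] \<or> vs = [z]"
    using uv(3) by (cases vs) (auto dest: list_emb_length split: if_splits)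
  then show thesis using uv skip take by auto
qed

lemma subseq_snocD:
  assumes "subseq (\<rho> @ [y]) (xs @ [z])"
  shows "subseq \<rho> xs"
  using assms
proof (cases rule: subseq_snocE)
  case skip
  have "subseq \<rho> (\<rho> @ [y])" by (intro subseq_rev_drop_many subseq_order.refl)
  then show ?thesis using skip by (rule subseq_order.trans)
qed

lemma subseq_snoc_neqD: "subseq (\<rho> @ [y]) (xs @ [z]) \<Longrightarrow> y \<noteq> z \<Longrightarrow> subseq (\<rho> @ [y]) xs"
  by (erule subseq_snocE) auto

lemma subseq_setD: "subseq xs ys \<Longrightarrow> x \<in> set xs \<Longrightarrow> x \<in> set ys"
  by (auto dest: list_emb_set)

lemma subseq_distinctD: "subseq xs ys \<Longrightarrow> distinct ys \<Longrightarrow> distinct xs"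
  by (metis distinct_nthsI subseq_conv_nths)

text \<open>The first entry of an occurrence is smaller than a later one, so a maximum in front
  cannot take part.\<close>

lemma has_x43_Cons_max:
  assumes "\<forall>v\<in>set \<pi>. v < n"
  shows "has_x43 (n # \<pi>) \<longleftrightarrow> has_x43 \<pi>"
proof
  assume "has_x43 (n # \<pi>)"
  then obtain a b c d where *: "subseq [a, b, d, c] (n # \<pi>)" "a < c" "b < c" "c < d"
    using has_x43_def by auto
  have "c \<in> set (n # \<pi>)" using subseq_setD[OF *(1)] by auto
  then have "a \<noteq> n" using *(2) assms by auto
  then have "subseq [a, b, d, c] \<pi>" using *(1) by (simp add: subseq_Cons2_iff)
  then show "has_x43 \<pi>" using * has_x43_def by blast
qed (auto intro: has_x43_mono)

text \<open>Since \<open>\<sigma>\<close> is nonempty, an occurrence starts with an entry below its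
  last one, hence not with \<open>n\<close>. For empty \<open>\<sigma>\<close> the entry
  \<open>n\<close> alone would be an occurrence.\<close>

lemma contains_snoc_Cons_max:
  assumes "\<forall>v\<in>set \<pi>. v < n" "\<forall>s\<in>set \<sigma>. s < M" "\<sigma> \<noteq> []"
  shows "contains (n # \<pi>) (\<sigma> @ [M]) \<longleftrightarrow> contains \<pi> (\<sigma> @ [M])"
proof
  assume "contains (n # \<pi>) (\<sigma> @ [M])"
  then obtain \<rho> y where *: "subseq (\<rho> @ [y]) (n # \<pi>)" "order_iso \<rho> \<sigma>" "\<forall>v\<in>set \<rho>. v < y"
    using contains_snoc_iff[OF assms(2)] by auto
  have "\<rho> \<noteq> []" using *(2) assms(3) by (auto simp: order_iso_def)
  then obtain r \<rho>' where r: "\<rho> = r # \<rho>'" by (cases \<rho>) auto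
  have "y \<in> set (n # \<pi>)" using subseq_setD[OF *(1)] by auto
  then have "r \<noteq> n" using *(3) r assms(1) by auto
  then have "subseq (\<rho> @ [y]) \<pi>" using *(1) r by (simp add: subseq_Cons2_iff)
  then show "contains \<pi> (\<sigma> @ [M])" using * contains_snoc_iff[OF assms(2)] by blast
qed (auto intro: contains_mono)

section \<open>Occurrences in a word split by its maximum\<close>

text \<open>The cases record whether the subsequence reaches beyond \<open>z\<close>; if it does,
  \<open>vs\<close> is nonempty and its last entry lies in \<open>ys\<close>.\<close>

lemma subseq_append_ConsE:
  assumes "subseq zs (xs @ z # ys)"
  obtains (left) "subseq zs (xs @ [z])"
  | (right) us vs where "zs = us @ vs" "vs \<noteq> []" "subseq us (xs @ [z])" "subseq vs ys"
proof -
  have "subseq zs ((xs @ [z]) @ ys)" using assms by simp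
  then obtain us vs where "zs = us @ vs" "subseq us (xs @ [z])" "subseq vs ys"
    using subseq_append_iff by metis
  then show thesis using left right by (cases "vs = []") auto
qed

text \<open>Models the word A N B with maximum \<open>N\<close>, where \<open>b\<close> stands for
  the least entry of \<open>A\<close>. Only comparisons are assumed, so the values need not fill an
  interval.\<close>

locale separated_lists =
  fixes A B :: "nat list" and N b :: nat
  assumes dist: "distinct A" and low: "\<forall>v\<in>set (b # B). v < N"
    and high: "\<forall>u\<in>set A. u = b \<or> (\<forall>v\<in>set (b # B). v < u)"
    and lessN: "\<forall>u\<in>set A. u < N"
begin

text \<open>The only entry of A N that can lie weakly below an entry of \<open>B\<close> is
  \<open>b\<close>. By distinctness \<open>us\<close> is then empty or \<open>[b]\<close>, so the
  occurrence can be moved into \<open>b # B\<close>.\<close>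

lemma subseq_merge:
  assumes "subseq us (A @ [N])" "subseq vs B" "\<forall>u\<in>set us. \<exists>c\<in>set B. u \<le> c"
  shows "subseq (us @ vs) (b # B)"
proof -
  have "u = b" if u: "u \<in> set us" for u
  proof -
    obtain c where c: "c \<in> set B" "u \<le> c" using assms(3) u by auto
    have "u \<in> set A \<or> u = N" using subseq_setD[OF assms(1) u] by auto
    then show ?thesis using c high low by fastforce
  qed
  moreover have "distinct us"
    using subseq_distinctD[OF assms(1)] dist lessN by auto
  \<comment> \<open>Splitting both \<open>us\<close> and \<open>tl us\<close> exposes two entries,
    which would be equal to \<open>b\<close> and hence to each other.\<close>
  ultimately have "us = [] \<or> us = [b]"
    by (cases us rule: list.exhaust[case_product list.exhaust, of _ "tl us"]) auto
  then show ?thesis using assms(2) by auto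
qed

text \<open>An occurrence inside A N leaves one of \<open>\<sigma>\<close> in \<open>A\<close> after
  dropping its last entry. Otherwise its last entry lies in \<open>B\<close> and dominates all the
  others, so \<open>subseq_merge\<close> applies.\<close>

lemma contains_snocD:
  assumes \<sigma>: "\<forall>s\<in>set \<sigma>. s < M" and "contains (A @ N # B) (\<sigma> @ [M])"
  shows "contains A \<sigma> \<or> contains (b # B) (\<sigma> @ [M])"
proof -
  obtain \<rho> y where *: "subseq (\<rho> @ [y]) (A @ N # B)" "order_iso \<rho> \<sigma>" "\<forall>v\<in>set \<rho>. v < y"
    using assms contains_snoc_iff by auto
  from *(1) show ?thesis
  proof (cases rule: subseq_append_ConsE)
    case left
    then show ?thesis using *(2) subseq_snocD[OF left] contains_iff by auto
  next
    case (right us vs)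
    have "y = last vs" using right(2) last_snoc[of \<rho> y] by (simp add: right(1))
    then have "y \<in> set B" using right(2) subseq_setD[OF right(4)] by auto
    moreover have "\<forall>u\<in>set us. u \<le> y"
    proof
      fix u assume "u \<in> set us"
      then have "u \<in> set (\<rho> @ [y])" using right(1) by simp
      then show "u \<le> y" using *(3) by auto
    qed
    ultimately have "subseq (\<rho> @ [y]) (b # B)"
      using subseq_merge[OF right(3,4)] right(1) by metis
    then show ?thesis using * contains_snoc_iff[OF \<sigma>] by blast
  qed
qed

text \<open>Here the last entry \<open>c\<close> is not the largest, so \<open>subseq_merge\<close>
  cannot be applied until \<open>d\<close> is known to lie in \<open>B\<close>.\<close>

lemma has_x43D:
  assumes "has_x43 (A @ N # B)"
  shows "has_x43 A \<or> has_x43 (b # B)"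
proof -
  obtain a b' c d where *: "subseq [a, b', d, c] (A @ N # B)" "a < c" "b' < c" "c < d"
    using assms has_x43_def by auto
  from *(1) show ?thesis
  proof (cases rule: subseq_append_ConsE)
    case left
    have "d \<in> set (A @ [N])" using subseq_setD[OF left] by auto
    then have "c \<noteq> N" using *(4) lessN by auto
    then have "subseq [a, b', d, c] A" using subseq_snoc_neqD[of "[a, b', d]"] left by simp
    then show ?thesis using * has_x43_def by blast
  next
    case (right us vs)
    have "c = last vs" using right(1,2) by (metis last.simps last_appendR list.distinct(1))
    then have c: "c \<in> set B" using right(2) subseq_setD[OF right(4)] by auto
    \<comment> \<open>If both \<open>a\<close> and \<open>b'\<close> preceded the split, both would
      lie below \<open>c\<close> in \<open>B\<close> and so equal \<open>b\<close>, against
      distinctness. Hence at most \<open>a\<close> comes from A N.\<close>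
    have us1: "us = [] \<or> us = [a]"
    proof (rule ccontr)
      assume "\<not> ?thesis"
      then obtain ws where us: "us = a # b' # ws"
        using right(1) by (cases us rule: list.exhaust[case_product list.exhaust, of _ "tl us"]) auto
      have "subseq [a, b'] (a # b' # ws)" by simp
      then have "subseq [a, b'] (A @ [N])" using right(3) us subseq_order.trans by metis
      from subseq_merge[OF this, of "[]"] have "subseq [a, b'] (b # B)"
        using c *(2,3) by fastforce
      moreover have "distinct [a, b']"
        using subseq_distinctD[OF \<open>subseq [a, b'] (A @ [N])\<close>] dist lessN by auto
      moreover have "{a, b'} \<subseteq> {b}"
      proof -
        have "{a, b'} \<subseteq> set (A @ [N])" using subseq_setD[OF \<open>subseq [a, b'] (A @ [N])\<close>] by auto
        then show ?thesis using c *(2,3) high low by fastforce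
      qed
      ultimately show False by auto
    qed
    then have "\<forall>u\<in>set us. \<exists>c\<in>set B. u \<le> c" using c *(2) less_imp_le by fastforce
    then have "subseq [a, b', d, c] (b # B)"
      using subseq_merge[OF right(3,4)] right(1) by metis
    then show ?thesis using * has_x43_def by blast
  qed
qed

end

section \<open>Gluing a pair of avoiders\<close>

text \<open>Undoes the standardisation of A: the least value 1 becomes b, the head of
  \<open>\<delta>\<close> = b B, and the larger values move above all values of
  \<open>\<delta>\<close>.\<close>

definition lift_low :: "nat list \<Rightarrow> nat \<Rightarrow> nat" where
  "lift_low \<delta> v = (if v = 1 then hd \<delta> else v + (length \<delta> - 1))"

text \<open>Rebuilds A n B from the standardisation \<open>\<gamma>\<close> of A and
  \<open>\<delta>\<close> = b B. The maximum is the sum of the two lengths, because b is counted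
  twice and n not at all.\<close>

definition glue :: "nat list \<Rightarrow> nat list \<Rightarrow> nat list" where
  "glue \<gamma> \<delta> = map (lift_low \<delta>) \<gamma> @ (length \<gamma> + length \<delta>) # tl \<delta>"

lemma strict_mono_on_lift_low:
  assumes "set \<gamma> = {1..m}" "set \<delta> = {1..length \<delta>}" "1 \<le> length \<delta>"
  shows "strict_mono_on (set \<gamma>) (lift_low \<delta>)"
proof -
  have "hd \<delta> \<in> set \<delta>" using assms(3) by (intro hd_in_set) auto
  then have "hd \<delta> \<le> length \<delta>" by (simp add: assms(2))
  then show ?thesis by (auto simp: strict_mono_on_def lift_low_def assms(1))
qed

lemma image_lift_low:
  assumes "1 \<le> m" "1 \<le> length \<delta>"
  shows "lift_low \<delta> ` {1..m} = insert (hd \<delta>) {length \<delta> + 1..<m + length \<delta>}"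
proof -
  have "v \<in> lift_low \<delta> ` {1..m}" if "length \<delta> < v" "v < m + length \<delta>" for v
    by (rule image_eqI[of _ _ "v - (length \<delta> - 1)"]) (use that assms in \<open>auto simp: lift_low_def\<close>)
  moreover have "hd \<delta> \<in> lift_low \<delta> ` {1..m}"
    by (rule image_eqI[of _ _ 1]) (use assms in \<open>auto simp: lift_low_def\<close>)
  ultimately have "insert (hd \<delta>) {length \<delta> + 1..<m + length \<delta>} \<subseteq> lift_low \<delta> ` {1..m}"
    by auto
  moreover have "lift_low \<delta> v \<in> insert (hd \<delta>) {length \<delta> + 1..<m + length \<delta>}"
    if "v \<in> {1..m}" for v
    using that assms by (auto simp: lift_low_def)
  ultimately show ?thesis by blast
qed

text \<open>A forbidden occurrence in A n B would yield one in A, hence in \<open>\<gamma>\<close>,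
  or one in \<open>\<delta>\<close>. The second conclusion separates glued words from those that
  begin with their maximum.\<close>

lemma glue_in_Av3:
  assumes \<gamma>: "\<gamma> \<in> Av3 \<sigma> m" and \<delta>: "\<delta> \<in> Av3 (\<sigma> @ [M]) l" and "1 \<le> m" "1 \<le> l"
    and M: "\<forall>s\<in>set \<sigma>. s < M"
  shows "glue \<gamma> \<delta> \<in> Av3 (\<sigma> @ [M]) (m + l)" and "hd (glue \<gamma> \<delta>) \<noteq> m + l"
proof -
  define A where "A = map (lift_low \<delta>) \<gamma>"
  note len = length_Av3[OF \<gamma>] length_Av3[OF \<delta>]
  obtain b B where bB: "\<delta> = b # B" using len(2) \<open>1 \<le> l\<close> by (cases \<delta>) auto
  have set\<delta>: "set (b # B) = {1..l}" using \<delta> bB by (simp add: Av3_iff)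
  have dist\<delta>: "distinct (b # B)" using \<delta> bB by (simp add: Av3_iff)
  have sm: "strict_mono_on (set \<gamma>) (lift_low \<delta>)"
    by (rule strict_mono_on_lift_low[of _ m]) (use \<gamma> \<delta> len \<open>1 \<le> l\<close> in \<open>auto simp: Av3_iff\<close>)
  have setA: "set A = insert b {l + 1..<m + l}"
  proof -
    have "hd \<delta> = b" using bB by simp
    then show ?thesis
      using image_lift_low[of m \<delta>] \<gamma> len(2) assms(3,4) by (simp add: A_def Av3_iff)
  qed
  have distA: "distinct A"
    using \<gamma> sm by (auto simp: A_def Av3_iff distinct_map intro: strict_mono_on_imp_inj_on)
  have b: "1 \<le> b" "b \<le> l" using set\<delta> by auto
  have glue: "glue \<gamma> \<delta> = A @ (m + l) # B"
    using len by (simp add: glue_def A_def bB)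
  interpret separated_lists A B "m + l" b
  proof
    show "distinct A" by (fact distA)
    show "\<forall>v\<in>set (b # B). v < m + l" "\<forall>u\<in>set A. u = b \<or> (\<forall>v\<in>set (b # B). v < u)"
      unfolding set\<delta> setA using \<open>1 \<le> m\<close> by auto
    show "\<forall>u\<in>set A. u < m + l" unfolding setA using b \<open>1 \<le> m\<close> by auto
  qed
  have "\<not> has_x43 A" "\<not> contains A \<sigma>"
    using \<gamma> has_x43_mapD[OF _ sm] contains_mapD[OF _ sm] by (auto simp: A_def Av3_iff)
  then have "\<not> has_x43 (glue \<gamma> \<delta>)" "\<not> contains (glue \<gamma> \<delta>) (\<sigma> @ [M])"
    using \<delta> has_x43D contains_snocD[OF M] unfolding glue unfolding bB Av3_iff by blast+
  moreover have setB: "set B = {1..l} - {b}" using set\<delta> dist\<delta> by auto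
  have "distinct (glue \<gamma> \<delta>)"
  proof -
    have "set A \<inter> set B = {}" unfolding setA setB by auto
    moreover have "m + l \<notin> set A" "m + l \<notin> set B" using lessN low by auto
    ultimately show ?thesis using distA dist\<delta> by (simp add: glue)
  qed
  moreover have "set (glue \<gamma> \<delta>) = {1..m + l}"
  proof -
    have "{1..m + l} = {1..l} \<union> {l + 1..<m + l} \<union> {m + l}" using \<open>1 \<le> m\<close> by auto
    moreover have "b \<in> {1..l}" using b by simp
    ultimately show ?thesis by (simp only: glue set_append list.set(2) setA setB) blast
  qed
  ultimately show "glue \<gamma> \<delta> \<in> Av3 (\<sigma> @ [M]) (m + l)" by (simp add: Av3_iff)
  have "A \<noteq> []" using setA by auto
  then have "hd (glue \<gamma> \<delta>) \<in> set A" by (simp add: glue)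
  then show "hd (glue \<gamma> \<delta>) \<noteq> m + l" using lessN by auto
qed

text \<open>The single entry n marks where A ends, so A and \<open>tl \<delta>\<close> can be read
  off; \<open>hd \<delta>\<close> is the minimum of A, and then \<open>\<gamma>\<close> is
  determined because \<open>lift_low \<delta>\<close> is injective on its entries.\<close>

lemma inj_on_glue:
  "inj_on (\<lambda>(m, \<gamma>, \<delta>). glue \<gamma> \<delta>) (SIGMA m:{1..<n}. Av3 \<sigma> m \<times> Av3 \<tau> (n - m))"
proof (rule inj_onI, clarify)
  have aux: "n \<notin> set (map (lift_low \<delta>) \<gamma>)" "hd \<delta> = Min (set (map (lift_low \<delta>) \<gamma>))"
    "\<delta> = hd \<delta> # tl \<delta>" "strict_mono_on (set \<gamma>) (lift_low \<delta>)"
    "n \<notin> set (tl \<delta>)"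
    if "m \<in> {1..<n}" "\<gamma> \<in> Av3 \<sigma> m" "\<delta> \<in> Av3 \<tau> (n - m)" for m \<gamma> \<delta>
  proof -
    note len = length_Av3[OF that(2)] length_Av3[OF that(3)]
    have "\<delta> \<noteq> []" using len that(1) by auto
    then show "\<delta> = hd \<delta> # tl \<delta>" by simp
    have "hd \<delta> \<in> set \<delta>" using \<open>\<delta> \<noteq> []\<close> by simp
    then have h: "hd \<delta> \<le> n - m" using that(3) by (auto simp: Av3_iff)
    have "1 \<le> m" "1 \<le> length \<delta>" "m + length \<delta> = n" using that(1) len by auto
    then have set: "set (map (lift_low \<delta>) \<gamma>) = insert (hd \<delta>) {n - m + 1..<n}"
      using image_lift_low[of m \<delta>] that(2) len(2) by (simp add: Av3_iff)
    then show "n \<notin> set (map (lift_low \<delta>) \<gamma>)" using h that(1) by auto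
    show "hd \<delta> = Min (set (map (lift_low \<delta>) \<gamma>))"
      unfolding set by (rule sym, rule Min_eqI) (use h in auto)
    have "n \<notin> set \<delta>" using that(1,3) by (auto simp: Av3_iff)
    then show "n \<notin> set (tl \<delta>)" by (cases \<delta>) auto
    show "strict_mono_on (set \<gamma>) (lift_low \<delta>)"
      by (rule strict_mono_on_lift_low[of _ m]) (use that len in \<open>auto simp: Av3_iff\<close>)
  qed
  fix m \<gamma> \<delta> m' \<gamma>' \<delta>'
  assume m: "m \<in> {1..<n}" and \<gamma>: "\<gamma> \<in> Av3 \<sigma> m" and \<delta>: "\<delta> \<in> Av3 \<tau> (n - m)"
    and m': "m' \<in> {1..<n}" and \<gamma>': "\<gamma>' \<in> Av3 \<sigma> m'" and \<delta>': "\<delta>' \<in> Av3 \<tau> (n - m')"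
    and eq: "glue \<gamma> \<delta> = glue \<gamma>' \<delta>'"
  note a = aux[OF m \<gamma> \<delta>] and a' = aux[OF m' \<gamma>' \<delta>']
  note len = length_Av3[OF \<gamma>] length_Av3[OF \<delta>] length_Av3[OF \<gamma>'] length_Av3[OF \<delta>']
  have "map (lift_low \<delta>) \<gamma> @ n # tl \<delta> = map (lift_low \<delta>') \<gamma>' @ n # tl \<delta>'"
    using eq m m' by (simp add: glue_def len)
  then have maps: "map (lift_low \<delta>) \<gamma> = map (lift_low \<delta>') \<gamma>'" and "tl \<delta> = tl \<delta>'"
    using append_Cons_eq_iff[OF a(1) a(5)] by auto
  then have \<delta>_eq: "\<delta> = \<delta>'" using a(2,3) a'(2,3) by metis
  have m_eq: "m = m'" using map_eq_imp_length_eq[OF maps] len by simp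
  have "set \<gamma> = set \<gamma>'" using \<gamma> \<gamma>' m_eq by (simp add: Av3_iff)
  then have "\<gamma> = \<gamma>'"
    using maps a(4) \<delta>_eq by (metis Un_absorb inj_on_map_eq_map strict_mono_on_imp_inj_on)
  then show "m = m' \<and> (\<gamma>, \<delta>) = (\<gamma>', \<delta>')" using m_eq \<delta>_eq by simp
qed

section \<open>Decomposition at the maximum\<close>

text \<open>A value up to \<open>Max X\<close> outside \<open>X\<close> would belong to
  \<open>Y\<close> and so exceed \<open>Max X\<close>. This shows later that b B needs no
  standardisation.\<close>

lemma initial_segment_eq:
  fixes X Y :: "nat set"
  assumes "X \<union> Y = {1..N}" "\<forall>x\<in>X. \<forall>y\<in>Y. x < y"
  shows "X = {1..card X}"
proof (cases "X = {}")
  case False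
  have fin: "finite X" using assms(1) by (metis finite_Un finite_atLeastAtMost)
  have MX: "Max X \<in> X" using fin False by simp
  have "X = {1..Max X}"
  proof
    show "X \<subseteq> {1..Max X}" using assms(1) fin by auto
    show "{1..Max X} \<subseteq> X"
    proof
      fix v assume v: "v \<in> {1..Max X}"
      have "Max X \<le> N" using MX assms(1) by auto
      then have "v \<in> X \<union> Y" using v assms(1) by auto
      then show "v \<in> X" using v MX assms(2) by fastforce
    qed
  qed
  then show ?thesis by (metis card_atLeastAtMost diff_Suc_1)
qed simp

text \<open>Converse of \<open>glue_in_Av3\<close>: since the word does not begin with
  \<open>n\<close>, the block A before \<open>n\<close> is nonempty and has a least entry.\<close>

lemma Av3_glueE:
  assumes \<pi>: "\<pi> \<in> Av3 (\<sigma> @ [M]) n" and "1 \<le> n" and hd: "hd \<pi> \<noteq> n"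
    and M: "\<forall>s\<in>set \<sigma>. s < M"
  obtains m \<gamma> \<delta> where "m \<in> {1..<n}" "\<gamma> \<in> Av3 \<sigma> m" "\<delta> \<in> Av3 (\<sigma> @ [M]) (n - m)" "\<pi> = glue \<gamma> \<delta>"
proof -
  have "n \<in> set \<pi>" using \<pi> \<open>1 \<le> n\<close> by (simp add: Av3_iff)
  then obtain A B where AB: "\<pi> = A @ n # B" by (meson split_list)
  have dist: "distinct (A @ n # B)" and no43: "\<not> has_x43 (A @ n # B)"
    and no\<sigma>: "\<not> contains (A @ n # B) (\<sigma> @ [M])" and "set (A @ n # B) = {1..n}"
    using \<pi> AB by (auto simp: Av3_iff)
  then have "set A \<union> set B = {1..n} - {n}" by auto
  also have "{1..n} - {n} = {1..n - 1}" by auto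
  finally have setAB: "set A \<union> set B = {1..n - 1}" .
  have less_n: "v < n" if "v \<in> set A \<union> set B" for v
    using that \<open>1 \<le> n\<close> unfolding setAB by auto
  have "A \<noteq> []" using hd AB by auto
  define m where "m = length A"
  define b where "b = Min (set A)"
  have b: "b \<in> set A" "\<forall>u\<in>set A. b \<le> u" using \<open>A \<noteq> []\<close> by (auto simp: b_def)
  define \<delta> where "\<delta> = b # B"
  have "n = length \<pi>" using length_Av3[OF \<pi>] by simp
  then have n: "n = m + length \<delta>" by (simp add: AB m_def \<delta>_def)
  have "1 \<le> m" using \<open>A \<noteq> []\<close> by (cases A) (auto simp: m_def)
  \<comment> \<open>Otherwise \<open>u\<close> and \<open>b\<close> both lie below \<open>c\<close>,
    and together with \<open>n\<close> and \<open>c\<close> they form 1243 or 2143.\<close>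
  have above: "c < u" if u: "u \<in> set A" "u \<noteq> b" and c: "c \<in> set B" for u c
  proof (rule ccontr)
    assume "\<not> c < u"
    moreover have "u \<noteq> c" using u c dist by auto
    ultimately have "u < c" by simp
    then have "b < c" using b u by (meson le_less_trans)
    have "c < n" using c less_n by simp
    have cB: "subseq [n, c] (n # B)" using c by (simp add: subseq_singleton_left)
    \<comment> \<open>Either order of \<open>u\<close> and \<open>b\<close> in \<open>A\<close> will
      do, as \<open>has_x43\<close> does not compare its first two entries.\<close>
    have "\<exists>x y. subseq [x, y] A \<and> {x, y} = {u, b}"
    proof -
      obtain ys zs where A: "A = ys @ u # zs" using u(1) by (meson split_list)
      consider "b \<in> set ys" | "b \<in> set zs" using b(1) u(2) A by auto
      then show ?thesis
      proof cases
        case 1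
        then have "subseq ([b] @ [u]) (ys @ (u # zs))"
          by (intro list_emb_append_mono) (auto simp: subseq_singleton_left)
        then show ?thesis using A by (intro exI[of _ b] exI[of _ u]) auto
      next
        case 2
        then have "subseq [u, b] (u # zs)" by (simp add: subseq_singleton_left)
        then have "subseq [u, b] A" using A subseq_drop_many by metis
        then show ?thesis by blast
      qed
    qed
    then obtain x y where xy: "subseq [x, y] A" "{x, y} = {u, b}" by blast
    have "subseq ([x, y] @ [n, c]) (A @ n # B)"
      using xy(1) cB by (rule list_emb_append_mono)
    moreover have "x < c" "y < c" using xy(2) \<open>u < c\<close> \<open>b < c\<close> by (auto simp: doubleton_eq_iff)
    ultimately have "has_x43 (A @ n # B)" using \<open>c < n\<close> unfolding has_x43_def by auto
    then show False using no43 by simp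
  qed
  have dist\<delta>: "distinct \<delta>" using dist b(1) by (auto simp: \<delta>_def)
  have "set \<delta> \<union> (set A - {b}) = {1..n - 1}" using setAB b(1) by (auto simp: \<delta>_def)
  moreover have "\<forall>x\<in>set \<delta>. \<forall>y\<in>set A - {b}. x < y"
    using above b by (auto simp: \<delta>_def le_neq_implies_less)
  ultimately have set\<delta>: "set \<delta> = {1..length \<delta>}"
    using initial_segment_eq[of "set \<delta>"] distinct_card[OF dist\<delta>] by metis
  have setA: "length \<delta> < u \<and> u < n" if "u \<in> set A" "u \<noteq> b" for u
  proof
    have "u \<notin> set \<delta>" using that dist by (auto simp: \<delta>_def)
    then show "length \<delta> < u" using set\<delta> that(1) setAB by auto
    show "u < n" using that(1) less_n by simp
  qed
  have l1: "1 \<le> length \<delta>" by (simp add: \<delta>_def)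
  \<comment> \<open>\<open>h\<close> standardises \<open>A\<close>; it is inverse to
    \<open>lift_low \<delta>\<close> on these entries.\<close>
  define h where "h u = (if u = b then 1 else u - (length \<delta> - 1))" for u
  have smh: "strict_mono_on (set A) h"
    using setA b l1 by (fastforce simp: strict_mono_on_def h_def)
  define \<gamma> where "\<gamma> = map h A"
  have dist\<gamma>: "distinct \<gamma>"
    using dist smh by (auto simp: \<gamma>_def distinct_map intro: strict_mono_on_imp_inj_on)
  \<comment> \<open>Inclusion together with equal cardinality replaces a proof of
    surjectivity.\<close>
  have "set \<gamma> \<subseteq> {1..m}" using setA n l1 \<open>1 \<le> m\<close> by (fastforce simp: \<gamma>_def h_def)
  moreover have "card (set \<gamma>) = m" using distinct_card[OF dist\<gamma>] by (simp add: \<gamma>_def m_def)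
  ultimately have set\<gamma>: "set \<gamma> = {1..m}" by (intro card_subset_eq) auto
  have "map (lift_low \<delta>) \<gamma> = A"
    using setA l1 by (fastforce simp: \<gamma>_def lift_low_def h_def \<delta>_def intro: map_idI)
  then have "\<pi> = glue \<gamma> \<delta>"
    using n by (simp add: glue_def AB) (simp add: \<gamma>_def m_def \<delta>_def)
  moreover have "\<gamma> \<in> Av3 \<sigma> m"
  proof -
    have "\<not> contains A \<sigma>"
    proof
      assume "contains A \<sigma>"
      then obtain \<rho> where \<rho>: "subseq \<rho> A" "order_iso \<rho> \<sigma>" using contains_iff by auto
      \<comment> \<open>The maximum \<open>n\<close> follows all of \<open>A\<close>, so it
        completes an occurrence of \<open>\<sigma>\<close> to one of
        \<open>\<sigma> @ [M]\<close>.\<close>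
      have "subseq (\<rho> @ [n]) (A @ n # B)"
        using \<rho>(1) by (intro list_emb_append_mono) auto
      moreover have "\<forall>v\<in>set \<rho>. v < n"
        using subseq_setD[OF \<rho>(1)] less_n by simp
      ultimately show False using no\<sigma> \<rho>(2) contains_snoc_iff[OF M] by blast
    qed
    moreover have "\<not> has_x43 A" using no43 has_x43_mono[of A "A @ n # B"] by auto
    ultimately show ?thesis
      using dist\<gamma> set\<gamma> contains_mapD[OF _ smh] has_x43_mapD[OF _ smh]
      by (auto simp: Av3_iff \<gamma>_def)
  qed
  moreover have "\<delta> \<in> Av3 (\<sigma> @ [M]) (n - m)"
  proof -
    \<comment> \<open>\<open>\<delta>\<close> is itself a subsequence of the word, since
      \<open>b\<close> lies in \<open>A\<close>, and therefore inherits avoidance.\<close>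
    have "subseq ([b] @ B) (A @ n # B)"
      using b(1) by (intro list_emb_append_mono) (auto simp: subseq_singleton_left)
    then have "subseq \<delta> (A @ n # B)" by (simp add: \<delta>_def)
    then show ?thesis
      using dist\<delta> set\<delta> n no43 no\<sigma> has_x43_mono contains_mono by (auto simp: Av3_iff)
  qed
  moreover have "m \<in> {1..<n}" using n l1 \<open>1 \<le> m\<close> by auto
  ultimately show thesis using that by blast
qed

section \<open>The counting recurrence\<close>

text \<open>This is the case of an empty block A; it accounts for the term at \<open>n - 1\<close>
  in the recurrence.\<close>

lemma Cons_in_Av3_iff:
  assumes "1 \<le> n" and M: "\<forall>s\<in>set \<sigma>. s < M" and "\<sigma> \<noteq> []"
  shows "n # \<beta> \<in> Av3 (\<sigma> @ [M]) n \<longleftrightarrow> \<beta> \<in> Av3 (\<sigma> @ [M]) (n - 1)"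
proof -
  have "distinct (n # \<beta>) \<and> set (n # \<beta>) = {1..n} \<longleftrightarrow> distinct \<beta> \<and> set \<beta> = {1..n - 1}"
  proof -
    have "{1..n} = insert n {1..n - 1}" using \<open>1 \<le> n\<close> by auto
    moreover have "n \<notin> {1..n - 1}" using \<open>1 \<le> n\<close> by auto
    ultimately show ?thesis using insert_ident[of n "set \<beta>" "{1..n - 1}"] by auto
  qed
  moreover have "\<forall>v\<in>set \<beta>. v < n" if "set \<beta> = {1..n - 1}" using \<open>1 \<le> n\<close> that by auto
  ultimately show ?thesis
    using has_x43_Cons_max[of \<beta> n] contains_snoc_Cons_max[of \<beta> n, OF _ M \<open>\<sigma> \<noteq> []\<close>]
    unfolding Av3_iff by blast
qed

text \<open>An avoider either begins with \<open>n\<close> or is glued from exactly one pair, and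
  the two cases exclude each other. For \<open>n = 1\<close> the first term counts the empty
  permutation, which gives the isolated x in the equation for the series of nonempty
  avoiders.\<close>

lemma card_Av3_snoc:
  assumes "1 \<le> n" and M: "\<forall>s\<in>set \<sigma>. s < M" and "\<sigma> \<noteq> []"
  shows "card (Av3 (\<sigma> @ [M]) n) = card (Av3 (\<sigma> @ [M]) (n - 1)) +
    (\<Sum>m=1..<n. card (Av3 \<sigma> m) * card (Av3 (\<sigma> @ [M]) (n - m)))"
proof -
  let ?\<tau> = "\<sigma> @ [M]"
  let ?S = "SIGMA m:{1..<n}. Av3 \<sigma> m \<times> Av3 ?\<tau> (n - m)"
  let ?J = "(\<lambda>(m, \<gamma>, \<delta>). glue \<gamma> \<delta>) ` ?S"
  let ?H = "(#) n ` Av3 ?\<tau> (n - 1)"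
  have J: "\<pi> \<in> Av3 ?\<tau> n \<and> hd \<pi> \<noteq> n" if \<pi>: "\<pi> \<in> ?J" for \<pi>
  proof -
    obtain m \<gamma> \<delta> where *: "m \<in> {1..<n}" "\<gamma> \<in> Av3 \<sigma> m" "\<delta> \<in> Av3 ?\<tau> (n - m)" "\<pi> = glue \<gamma> \<delta>"
      using \<pi> by auto
    moreover from *(1) have "1 \<le> m" "1 \<le> n - m" "m + (n - m) = n" by auto
    ultimately show ?thesis using glue_in_Av3[OF *(2,3) _ _ M] by metis
  qed
  have "Av3 ?\<tau> n = ?H \<union> ?J"
  proof
    show "?H \<union> ?J \<subseteq> Av3 ?\<tau> n" using J Cons_in_Av3_iff[OF assms] by blast
    show "Av3 ?\<tau> n \<subseteq> ?H \<union> ?J"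
    proof
      fix \<pi> assume \<pi>: "\<pi> \<in> Av3 ?\<tau> n"
      show "\<pi> \<in> ?H \<union> ?J"
      proof (cases "hd \<pi> = n")
        case True
        have "\<pi> \<noteq> []" using length_Av3[OF \<pi>] \<open>1 \<le> n\<close> by auto
        then obtain \<beta> where "\<pi> = n # \<beta>" using True by (cases \<pi>) auto
        then show ?thesis using \<pi> Cons_in_Av3_iff[OF assms] by blast
      next
        case False
        then obtain m \<gamma> \<delta> where
          "m \<in> {1..<n}" "\<gamma> \<in> Av3 \<sigma> m" "\<delta> \<in> Av3 ?\<tau> (n - m)" "\<pi> = glue \<gamma> \<delta>"
          using Av3_glueE[OF \<pi> \<open>1 \<le> n\<close> _ M] by blast
        then have "\<pi> \<in> ?J" by (intro image_eqI[of _ _ "(m, \<gamma>, \<delta>)"]) auto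
        then show ?thesis by simp
      qed
    qed
  qed
  moreover have "hd \<pi> = n" if "\<pi> \<in> ?H" for \<pi> using that by auto
  then have "?H \<inter> ?J = {}" using J by blast
  ultimately have "card (Av3 ?\<tau> n) = card ?H + card ?J"
    using finite_Av3 by (simp add: card_Un_disjoint finite_SigmaI)
  also have "card ?H = card (Av3 ?\<tau> (n - 1))" by (intro card_image) auto
  also have "card ?J = card ?S" by (rule card_image[OF inj_on_glue])
  also have "card ?S = (\<Sum>m=1..<n. card (Av3 \<sigma> m) * card (Av3 ?\<tau> (n - m)))"
    by (simp add: card_SigmaI finite_Av3 card_cartesian_product)
  finally show ?thesis .
qed

section \<open>Patterns of length one and two\<close>

lemma Av3_0: "\<tau> \<noteq> [] \<Longrightarrow> Av3 \<tau> 0 = {[]}"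
  by (auto simp: Av3_iff has_x43_def contains_def)

lemma Av3_singleton:
  assumes "1 \<le> n" shows "Av3 [t] n = {}"
proof -
  have "contains (v # \<pi>) [t]" for v \<pi>
    unfolding contains_def by (intro exI[of _ "[v]"]) auto
  then have "\<not> contains \<pi> [t] \<Longrightarrow> \<pi> = []" for \<pi> by (cases \<pi>) auto
  then show ?thesis using assms by (force simp: Av3_iff)
qed

lemma contains_21_iff: "contains \<pi> [2, 1] \<longleftrightarrow> (\<exists>x y. subseq [x, y] \<pi> \<and> y < x)"
proof
  assume "contains \<pi> [2, 1]"
  then obtain zs where zs: "subseq zs \<pi>" "order_iso zs [2, 1]" using contains_iff by auto
  then obtain x y where "zs = [x, y]" by (auto simp: order_iso_def length_Suc_conv)
  moreover have "\<forall>i<2. \<forall>j<2. zs ! i < zs ! j \<longleftrightarrow> [2, 1] ! i < ([2, 1] :: nat list) ! j"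
    using zs(2) by (simp add: order_iso_def)
  from this[rule_format, of 1 0] have "zs ! 1 < zs ! 0" by simp
  ultimately show "\<exists>x y. subseq [x, y] \<pi> \<and> y < x" using zs(1) by auto
next
  assume "\<exists>x y. subseq [x, y] \<pi> \<and> y < x"
  then obtain x y where "subseq [x, y] \<pi>" "y < x" by blast
  moreover from this have "order_iso [x, y] [2, 1]"
    by (auto simp: order_iso_def less_Suc_eq nth_Cons')
  ultimately show "contains \<pi> [2, 1]" using contains_iff by blast
qed

lemma sorted_iff_no_21: "sorted \<pi> \<longleftrightarrow> \<not> contains \<pi> [2, 1]"
proof
  assume "sorted \<pi>"
  then have "sorted zs" if "subseq zs \<pi>" for zs
    using that by (metis sorted_nths subseq_conv_nths)
  then show "\<not> contains \<pi> [2, 1]" unfolding contains_21_iff by fastforce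
next
  assume "\<not> contains \<pi> [2, 1]"
  then show "sorted \<pi>"
  proof (induction \<pi>)
    case (Cons v \<pi>)
    have "v \<le> w" if "w \<in> set \<pi>" for w
    proof (rule ccontr)
      assume "\<not> v \<le> w"
      moreover have "subseq [v, w] (v # \<pi>)" using that by (simp add: subseq_singleton_left)
      ultimately show False using Cons.prems contains_21_iff[of "v # \<pi>"] by (meson not_le)
    qed
    moreover have "\<not> contains \<pi> [2, 1]" using Cons.prems contains_mono[of \<pi> "v # \<pi>"] by auto
    ultimately show ?case using Cons.IH by simp
  qed simp
qed

text \<open>An occurrence of 1243 or 2143 contains the descent \<open>d\<close>, \<open>c\<close>,
  so sorted words avoid both automatically. The pattern 21 is treated directly because it is not 1
  followed by a new maximum.\<close>

lemma Av3_21: "Av3 [2, 1] n = {[1..<n + 1]}"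
proof -
  have "\<not> has_x43 \<pi>" if "sorted \<pi>" for \<pi>
  proof
    assume "has_x43 \<pi>"
    then obtain a b c d where *: "subseq [a, b, d, c] \<pi>" "c < d" using has_x43_def by auto
    have "subseq [d, c] [a, b, d, c]" using subseq_drop_many[of "[d, c]" "[d, c]" "[a, b]"] by simp
    then have "subseq [d, c] \<pi>" using *(1) by (rule subseq_order.trans)
    then show False using that *(2) sorted_iff_no_21 contains_21_iff by blast
  qed
  then have 1: "\<pi> \<in> Av3 [2, 1] n \<longleftrightarrow> distinct \<pi> \<and> set \<pi> = {1..n} \<and> sorted \<pi>" for \<pi>
    unfolding Av3_iff sorted_iff_no_21 by blast
  have 2: "distinct \<pi> \<and> set \<pi> = {1..n} \<and> sorted \<pi> \<longleftrightarrow> \<pi> = [1..<n + 1]" for \<pi>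
    using sorted_distinct_set_unique[of \<pi> "[1..<n + 1]"] sorted_upt[of 1 "n + 1"]
    by (auto simp del: upt_Suc simp: atLeastLessThanSuc_atLeastAtMost)
  show ?thesis by (rule set_eqI) (simp only: 1 2 singleton_iff)
qed

section \<open>Generating functions on a common interval\<close>

text \<open>The recurrence is the coefficient form of B = x + x B + A B. Nonnegativity turns it into
  a bound on the partial sums, so convergence is established before the equation is solved for
  B.\<close>

lemma convolution_recurrence_sums:
  fixes a b :: "nat \<Rightarrow> real"
  assumes a: "(\<lambda>n. a n * x ^ n) sums A" and pos: "\<And>n. 0 \<le> a n" "\<And>n. 0 \<le> b n"
    and "a 0 = 0" "b 0 = 0"
    and rec: "\<And>n. b (Suc n) = (if n = 0 then 1 else b n) + (\<Sum>i\<le>Suc n. a i * b (Suc n - i))"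
    and "0 < x" "x + A < 1"
  shows "(\<lambda>n. b n * x ^ n) sums (x / (1 - x - A))"
proof -
  define \<alpha> where "\<alpha> n = a n * x ^ n" for n
  define \<beta> where "\<beta> n = b n * x ^ n" for n
  define \<gamma> where "\<gamma> n = (\<Sum>i\<le>n. \<alpha> i * \<beta> (n - i))" for n
  have \<alpha>0: "0 \<le> \<alpha> n" and \<beta>0: "0 \<le> \<beta> n" for n
    using pos \<open>0 < x\<close> by (auto simp: \<alpha>_def \<beta>_def)
  have \<alpha>: "\<alpha> sums A" using a by (simp add: \<alpha>_def[abs_def])
  \<comment> \<open>At \<open>n = 0\<close> the truncated \<open>n - 1\<close> is 0, which is
    harmless as \<open>\<beta> 0 = 0\<close>; at \<open>n = 1\<close> the summand \<open>x\<close>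
    stands for the empty permutation.\<close>
  have \<beta>_rec: "\<beta> n = (if n = 1 then x else 0) + x * \<beta> (n - 1) + \<gamma> n" for n
  proof (cases n)
    case 0
    then show ?thesis using \<open>a 0 = 0\<close> \<open>b 0 = 0\<close> by (simp add: \<beta>_def \<gamma>_def)
  next
    case (Suc k)
    have "\<gamma> n = (\<Sum>i\<le>n. a i * b (n - i) * x ^ n)"
      unfolding \<gamma>_def
    proof (rule sum.cong)
      fix i assume "i \<in> {..n}"
      then have "x ^ n = x ^ i * x ^ (n - i)" by (simp flip: power_add)
      then show "\<alpha> i * \<beta> (n - i) = a i * b (n - i) * x ^ n" by (simp add: \<alpha>_def \<beta>_def)
    qed simp
    then have "\<gamma> n = (\<Sum>i\<le>n. a i * b (n - i)) * x ^ n" by (simp add: sum_distrib_right)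
    then show ?thesis
      using rec[of k] \<open>b 0 = 0\<close> Suc by (auto simp: \<beta>_def algebra_simps)
  qed
  have bound: "(\<Sum>n<N. \<beta> n) \<le> x / (1 - x - A)" for N
  proof -
    let ?S = "\<Sum>n<N. \<beta> n"
    have "0 \<le> ?S" using \<beta>0 by (simp add: sum_nonneg)
    have 1: "(\<Sum>n<N. if n = 1 then x else 0) \<le> x" using \<open>0 < x\<close> by (simp add: sum.delta)
    have 2: "(\<Sum>n<N. \<beta> (n - 1)) \<le> ?S"
    proof (cases N)
      case (Suc N')
      have "(\<Sum>n<N. \<beta> (n - 1)) = (\<Sum>n<N'. \<beta> n)"
        using \<open>b 0 = 0\<close> by (simp only: Suc sum.lessThan_Suc_shift) (simp add: \<beta>_def)
      also have "\<dots> \<le> ?S" using \<beta>0 by (simp add: Suc)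
      finally show ?thesis .
    qed simp
    \<comment> \<open>The convolution terms fill the triangle \<open>i + j < N\<close>; enlarging it
      to a square adds only nonnegative products and makes the sum factor.\<close>
    have "(\<Sum>n<N. \<gamma> n) = (\<Sum>(i, j)\<in>{(i, j). i + j < N}. \<alpha> i * \<beta> j)"
      unfolding \<gamma>_def by (simp add: sum.triangle_reindex)
    also have "\<dots> \<le> (\<Sum>(i, j)\<in>{..<N} \<times> {..<N}. \<alpha> i * \<beta> j)"
      by (rule sum_mono2) (auto simp: \<alpha>0 \<beta>0)
    also have "\<dots> = (\<Sum>n<N. \<alpha> n) * ?S"
      by (simp add: sum_product sum.cartesian_product)
    also have "\<dots> \<le> A * ?S"
      using sum_le_suminf[OF sums_summable[OF \<alpha>], of "{..<N}"] \<alpha>0 sums_unique[OF \<alpha>] \<open>0 \<le> ?S\<close>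
      by (intro mult_right_mono) auto
    finally have 3: "(\<Sum>n<N. \<gamma> n) \<le> A * ?S" .
    have "?S = (\<Sum>n<N. if n = 1 then x else 0) + x * (\<Sum>n<N. \<beta> (n - 1)) + (\<Sum>n<N. \<gamma> n)"
      by (subst \<beta>_rec) (simp add: sum.distrib sum_distrib_left)
    also have "\<dots> \<le> x + x * ?S + A * ?S"
      using 1 2 3 \<open>0 < x\<close> by (intro add_mono mult_left_mono) auto
    finally have "?S * (1 - x - A) \<le> x" by (simp add: algebra_simps)
    then show ?thesis using \<open>x + A < 1\<close> by (simp add: pos_le_divide_eq)
  qed
  have \<beta>_summable: "summable \<beta>"
    by (rule summableI_nonneg_bounded[OF \<beta>0 bound])
  define B where "B = suminf \<beta>"
  have \<beta>: "\<beta> sums B" using \<beta>_summable by (simp add: B_def summable_sums)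
  have "\<gamma> sums (A * B)"
    unfolding \<gamma>_def B_def sums_unique[OF \<alpha>]
    using \<alpha>0 \<beta>0 sums_summable[OF \<alpha>] \<beta>_summable by (intro Cauchy_product_sums) auto
  moreover have "(\<lambda>n. x * \<beta> (n - 1)) sums (x * B)"
  proof (rule sums_mult)
    show "(\<lambda>n. \<beta> (n - 1)) sums B"
    proof -
      have "\<beta> 0 = 0" using \<open>b 0 = 0\<close> by (simp add: \<beta>_def)
      then show ?thesis using sums_Suc_iff[of "\<lambda>n. \<beta> (n - 1)" B] \<beta> by simp
    qed
  qed
  moreover have "(\<lambda>n. if n = 1 then x else 0) sums x" by (rule sums_single)
  ultimately have "(\<lambda>n. (if n = 1 then x else 0) + x * \<beta> (n - 1) + \<gamma> n) sums (x + x * B + A * B)"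
    by (intro sums_add)
  then have "\<beta> sums (x + x * B + A * B)" by (subst (asm) \<beta>_rec[symmetric])
  then have "x + x * B + A * B = B" using \<beta> sums_unique2 by blast
  then have "B = x / (1 - x - A)" using \<open>x + A < 1\<close> by (simp add: field_simps)
  then show ?thesis using \<beta> by (simp add: \<beta>_def[abs_def])
qed

text \<open>The three-term Chebyshev recurrence turns the quotients \<open>G k\<close> into the
  iteration G -> x / (1 - x - G), which the series of the counts satisfy as well.\<close>

lemma chebyshev_continued_fraction_sums:
  fixes c :: "nat \<Rightarrow> nat \<Rightarrow> nat"
  assumes c0: "\<And>k. 1 \<le> k \<Longrightarrow> c k 0 = 1"
    and c1: "\<And>n. 1 \<le> n \<Longrightarrow> c 1 n = 0"
    and rec: "\<And>k n. 1 \<le> k \<Longrightarrow> 1 \<le> n \<Longrightarrow>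
      c (Suc k) n = c (Suc k) (n - 1) + (\<Sum>m=1..<n. c k m * c (Suc k) (n - m))"
    and x: "0 < x" "x < 1 / 6" and "1 \<le> k"
  defines "y \<equiv> (1 - x) / (2 * sqrt x)"
  shows "(\<lambda>n. real (c k n) * x ^ n) sums
    (1 + sqrt x * chebU (int k - 2) y / chebU (int k - 1) y)"
proof -
  \<comment> \<open>The constant term is removed, so that \<open>f k\<close> counts nonempty
    permutations; it is added back at the end.\<close>
  define f where "f k n = (if n = 0 then 0 else real (c k n))" for k n
  define G where "G k = sqrt x * chebV (k - 1) y / chebV k y" for k
  have sq: "sqrt x * sqrt x = x" "0 < sqrt x" using x by auto
  \<comment> \<open>With \<open>x < 1 / 6\<close> and \<open>G k \<le> 1 / 2\<close> the denominator
    \<open>1 - x - G k\<close> exceeds 1/3, so the next quotient is again at most 1/2. The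
    nonvanishing of \<open>chebV k y\<close> is carried along because the quotients divide by
    it.\<close>
  have main: "chebV k y \<noteq> 0 \<and> G k \<le> 1 / 2 \<and> (\<lambda>n. f k n * x ^ n) sums G k"
    using \<open>1 \<le> k\<close>
  proof (induction k rule: nat_induct_at_least)
    case base
    have "f 1 n = 0" for n using c1 by (simp add: f_def)
    then show ?case by (simp add: G_def)
  next
    case (Suc k)
    then obtain j where j: "k = Suc j" by (cases k) auto
    from Suc have V: "chebV k y \<noteq> 0" and G: "G k \<le> 1 / 2"
      and sums: "(\<lambda>n. f k n * x ^ n) sums G k" by auto
    have den: "0 < 1 - x - G k" using G x by simp
    \<comment> \<open>Writing \<open>chebV j y\<close> through \<open>G k\<close> makes
      \<open>chebV k y\<close> a common factor, with cofactor
      \<open>(1 - x - G k) / sqrt x\<close>.\<close>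
    have "chebV (Suc k) y = 2 * y * chebV k y - chebV j y" by (simp add: j)
    also have "2 * y = (1 - x) / sqrt x" using sq by (simp add: y_def field_simps)
    also have "chebV j y = G k / sqrt x * chebV k y"
      using V sq by (simp add: G_def j)
    finally have V': "chebV (Suc k) y = (1 - x - G k) / sqrt x * chebV k y"
      by (simp add: diff_divide_distrib left_diff_distrib)
    have "sqrt x * v / (g / sqrt x * v) = x / g" if "v \<noteq> 0" "g \<noteq> 0" for v g
      using sq that by (simp add: field_simps)
    then have G': "G (Suc k) = x / (1 - x - G k)"
      using V den by (simp add: G_def[of "Suc k"] V')
    have "x / (1 - x - G k) \<le> 1 / 2" using den G x by (simp add: divide_le_eq)
    moreover have "(\<lambda>n. f (Suc k) n * x ^ n) sums (x / (1 - x - G k))"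
    proof (rule convolution_recurrence_sums[OF sums])
      fix n
      have "f (Suc k) (Suc n) = real (c (Suc k) n) +
          (\<Sum>m=1..<Suc n. real (c k m) * real (c (Suc k) (Suc n - m)))"
        using rec[of k "Suc n"] Suc.hyps by (simp add: f_def)
      also have "real (c (Suc k) n) = (if n = 0 then 1 else f (Suc k) n)"
        using c0[of "Suc k"] by (simp add: f_def)
      \<comment> \<open>The added indices \<open>0\<close> and \<open>Suc n\<close> contribute
        nothing because \<open>f\<close> vanishes at 0.\<close>
      also have "(\<Sum>m=1..<Suc n. real (c k m) * real (c (Suc k) (Suc n - m))) =
          (\<Sum>m\<le>Suc n. f k m * f (Suc k) (Suc n - m))"
        by (rule sum.mono_neutral_cong_left) (auto simp: f_def)
      finally show "f (Suc k) (Suc n) = (if n = 0 then 1 else f (Suc k) n) +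
          (\<Sum>m\<le>Suc n. f k m * f (Suc k) (Suc n - m))" .
    qed (use x den in \<open>auto simp: f_def\<close>)
    ultimately show ?case using V V' sq den G' by simp
  qed
  have "(\<lambda>n. (if n = 0 then 1 else 0) + f k n * x ^ n) sums (1 + G k)"
    using main by (intro sums_add sums_single) auto
  also have "(\<lambda>n. (if n = 0 then 1 else 0) + f k n * x ^ n) = (\<lambda>n. real (c k n) * x ^ n)"
    using c0[OF \<open>1 \<le> k\<close>] by (auto simp: f_def)
  also have "G k = sqrt x * chebU (int k - 2) y / chebU (int k - 1) y"
    using \<open>1 \<le> k\<close> by (simp add: G_def chebU_def nat_diff_distrib)
  finally show ?thesis .
qed

section \<open>The two families of patterns\<close>

lemma idpat_Suc: "idpat (Suc k) = idpat k @ [Suc k]"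
  by (simp add: idpat_def)

lemma pat213_Suc: "2 \<le> k \<Longrightarrow> pat213 (Suc k) = pat213 k @ [Suc k]"
  by (simp add: pat213_def)

lemma pat213_2: "pat213 2 = [2, 1]"
  by (simp add: pat213_def)

lemma card_Av3_idpat_rec:
  assumes "1 \<le> k" "1 \<le> n"
  shows "card (Av3 (idpat (Suc k)) n) = card (Av3 (idpat (Suc k)) (n - 1)) +
    (\<Sum>m=1..<n. card (Av3 (idpat k) m) * card (Av3 (idpat (Suc k)) (n - m)))"
  unfolding idpat_Suc using assms by (intro card_Av3_snoc) (auto simp: idpat_def)

lemma card_Av3_pat213_rec:
  assumes "1 \<le> k" "1 \<le> n"
  shows "card (Av3 (pat213 (Suc k)) n) = card (Av3 (pat213 (Suc k)) (n - 1)) +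
    (\<Sum>m=1..<n. card (Av3 (pat213 k) m) * card (Av3 (pat213 (Suc k)) (n - m)))"
proof (cases "k = 1")
  case True
  \<comment> \<open>The step from 1 to 21 appends no maximum. The recurrence still holds: each
    length has one increasing permutation, and the products vanish because no nonempty permutation
    avoids 1.\<close>
  have "pat213 (Suc 1) = [2, 1]" "pat213 1 = [1]"
    using pat213_2 by (simp_all add: numeral_2_eq_2 pat213_def)
  then show ?thesis using True by (simp only: Av3_21) (simp add: Av3_singleton)
next
  case False
  then have k: "2 \<le> k" using assms(1) by simp
  show ?thesis
    unfolding pat213_Suc[OF k] using assms(2) k
    by (intro card_Av3_snoc) (auto simp: pat213_def)
qed

theorem mainTheorem3:
  fixes k :: nat
  assumes "k \<ge> 1"
  shows "\<exists>r>0. \<forall>x::real. 0 < x \<and> x < r \<longrightarrow>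
    ((\<lambda>n. real (card (Av n {[1,2,4,3], [2,1,4,3], idpat k})) * x ^ n) sums
       (1 + sqrt x * chebU (int k - 2) ((1 - x) / (2 * sqrt x))
                   / chebU (int k - 1) ((1 - x) / (2 * sqrt x))))
  \<and> ((\<lambda>n. real (card (Av n {[1,2,4,3], [2,1,4,3], pat213 k})) * x ^ n) sums
       (1 + sqrt x * chebU (int k - 2) ((1 - x) / (2 * sqrt x))
                   / chebU (int k - 1) ((1 - x) / (2 * sqrt x))))"
proof (intro exI[of _ "1 / 6"] conjI allI impI)
  fix x :: real
  assume "0 < x \<and> x < 1 / 6"
  then have x: "0 < x" "x < 1 / 6" by auto
  have c0: "card (Av3 (idpat k) 0) = 1" "card (Av3 (pat213 k) 0) = 1" if "1 \<le> k" for k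
    using that by (auto simp: Av3_0 idpat_def pat213_def)
  have c1: "card (Av3 (idpat 1) n) = 0" "card (Av3 (pat213 1) n) = 0" if "1 \<le> n" for n
    using that by (simp_all add: Av3_singleton idpat_def pat213_def)
  show "(\<lambda>n. real (card (Av n {[1,2,4,3], [2,1,4,3], idpat k})) * x ^ n) sums
       (1 + sqrt x * chebU (int k - 2) ((1 - x) / (2 * sqrt x))
                   / chebU (int k - 1) ((1 - x) / (2 * sqrt x)))"
    \<comment> \<open>Both families start from the pattern 1 and obey the same recurrence, so one
      analytic statement serves for both series.\<close>
    using chebyshev_continued_fraction_sums[where c = "\<lambda>k n. card (Av3 (idpat k) n)",
        OF c0(1) c1(1) card_Av3_idpat_rec x assms]
    unfolding Av3_def .
  show "(\<lambda>n. real (card (Av n {[1,2,4,3], [2,1,4,3], pat213 k})) * x ^ n) sums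
       (1 + sqrt x * chebU (int k - 2) ((1 - x) / (2 * sqrt x))
                   / chebU (int k - 1) ((1 - x) / (2 * sqrt x)))"
    using chebyshev_continued_fraction_sums[where c = "\<lambda>k n. card (Av3 (pat213 k) n)",
        OF c0(2) c1(2) card_Av3_pat213_rec x assms]
    unfolding Av3_def .
qed simp

end
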